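(* Assume the P-Ideal Dichotomy (PID) and $\mathfrak b > \aleph_1$. Then every locally compact, $\omega_1$-compact, normal space of cardinality $\aleph_1$ is $\sigma$-countably compact.
   Context: "Space" means Hausdorff topological space. A space is $\omega_1$-compact if each of its closed discrete subspaces is countable. A space is $\sigma$-countably compact if it is the union of countably many countably compact subspaces. $\mathfrak b$ is the bounding number: the least cardinality of a subset of $\omega^\omega$ that is unbounded with respect to $\le^*$. A family $\mathcal I\subset\mathcal P(X)$ is an ideal on a set $X$ if it is closed under finite unions, contains all singletons, and is closed under taking subsets of its elements. An ideal $\mathcal I$ is a P-ideal if for every countable subfamily $\mathcal Q$ of $\mathcal I$ there exists $I\in\mathcal I$ such that $Q\setminus I$ is finite for every $Q\in\mathcal Q$. The PID states that, for every P-ideal $\mathcal I$ of subsets of a set $X$, either (A) there is an uncountable $A\subset X$ such that every countable subset of $A$ is in $\mathcal I$, or (B) $X$ is the union of countably many sets $\{B_n:n\in\omega\}$ such that $B_n\cap I$ is finite for all $n$ and all $I\in\mathcal I$. *)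

theory Defs
  imports "HOL-Analysis.Analysis"
begin

unbundle cardinal_syntax

definition countably_compact_space :: "'a topology \<Rightarrow> bool" where
  "countably_compact_space X \<longleftrightarrow>
     (\<forall>\<U>. countable \<U> \<and> (\<forall>U\<in>\<U>. openin X U) \<and> topspace X \<subseteq> \<Union>\<U>
        \<longrightarrow> (\<exists>\<F>. finite \<F> \<and> \<F> \<subseteq> \<U> \<and> topspace X \<subseteq> \<Union>\<F>))"

definition sigma_countably_compact_space :: "'a topology \<Rightarrow> bool" where
  "sigma_countably_compact_space X \<longleftrightarrow>
     (\<exists>\<C>. countable \<C> \<and> \<Union>\<C> = topspace X \<and>
        (\<forall>C\<in>\<C>. countably_compact_space (subtopology X C)))"

definition omega1_compact_space :: "'a topology \<Rightarrow> bool" where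
  "omega1_compact_space X \<longleftrightarrow>
     (\<forall>C. closedin X C \<and> subtopology X C = discrete_topology C \<longrightarrow> countable C)"

definition set_ideal_on :: "'a set \<Rightarrow> 'a set set \<Rightarrow> bool" where
  "set_ideal_on X \<I> \<longleftrightarrow>
     \<I> \<subseteq> Pow X \<and>
     (\<forall>\<F>. finite \<F> \<and> \<F> \<subseteq> \<I> \<longrightarrow> \<Union>\<F> \<in> \<I>) \<and>
     (\<forall>x\<in>X. {x} \<in> \<I>) \<and>
     (\<forall>I\<in>\<I>. \<forall>J. J \<subseteq> I \<longrightarrow> J \<in> \<I>)"

definition P_ideal_on :: "'a set \<Rightarrow> 'a set set \<Rightarrow> bool" where
  "P_ideal_on X \<I> \<longleftrightarrow>
     set_ideal_on X \<I> \<and>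
     (\<forall>\<Q>. countable \<Q> \<and> \<Q> \<subseteq> \<I> \<longrightarrow> (\<exists>I\<in>\<I>. \<forall>Q\<in>\<Q>. finite (Q - I)))"

text \<open>HOL cannot quantify over types inside a formula, so the P-Ideal Dichotomy is stated
  for all sets of elements of a given type.\<close>

definition P_Ideal_Dichotomy :: "'a itself \<Rightarrow> bool" where
  "P_Ideal_Dichotomy (_ :: 'a itself) \<longleftrightarrow>
     (\<forall>(X :: 'a set) \<I>. P_ideal_on X \<I> \<longrightarrow>
        (\<exists>A. A \<subseteq> X \<and> uncountable A \<and> (\<forall>C. C \<subseteq> A \<and> countable C \<longrightarrow> C \<in> \<I>)) \<or>
        (\<exists>B :: nat \<Rightarrow> 'a set. X = (\<Union>n. B n) \<and> (\<forall>n. \<forall>I\<in>\<I>. finite (B n \<inter> I))))"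

definition eventually_dominated :: "(nat \<Rightarrow> nat) \<Rightarrow> (nat \<Rightarrow> nat) \<Rightarrow> bool"
    (infix "\<le>\<^sup>*" 50) where
  "f \<le>\<^sup>* g \<longleftrightarrow> (\<forall>\<^sub>F n in sequentially. f n \<le> g n)"

definition unbounded_family :: "(nat \<Rightarrow> nat) set \<Rightarrow> bool" where
  "unbounded_family F \<longleftrightarrow> \<not> (\<exists>g. \<forall>f\<in>F. f \<le>\<^sup>* g)"

text \<open>Cardinals are represented by well-order relations up to \<open>=o\<close>; the choice picks
  an unbounded family of least cardinality.\<close>

definition bounding_number :: "(nat \<Rightarrow> nat) rel" where
  "bounding_number =
     |SOME F. unbounded_family F \<and> (\<forall>G. unbounded_family G \<longrightarrow> |F| \<le>o |G| )|"

lemma bounding_number_attained: "\<exists>F. unbounded_family F \<and> |F| = bounding_number"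
  and bounding_number_least: "unbounded_family G \<Longrightarrow> bounding_number \<le>o |G|"
proof -
  have "unbounded_family UNIV"
  proof -
    have "\<not> (\<lambda>n. Suc (g n)) \<le>\<^sup>* g" for g
      by (simp add: eventually_dominated_def)
    then show ?thesis
      unfolding unbounded_family_def by blast
  qed
  then have "\<exists>r\<in>card_of ` Collect unbounded_family.
      \<forall>r'\<in>card_of ` Collect unbounded_family. r \<le>o r'"
    by (intro exists_minim_Card_order) (auto simp: card_of_Card_order)
  then have "\<exists>F. unbounded_family F \<and> (\<forall>G. unbounded_family G \<longrightarrow> |F| \<le>o |G| )"
    by blast
  from someI_ex[OF this]
  show "\<exists>F. unbounded_family F \<and> |F| = bounding_number"
    and "unbounded_family G \<Longrightarrow> bounding_number \<le>o |G|"
    unfolding bounding_number_def by blast+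
qed

definition aleph_one :: "nat set rel" where
  "aleph_one = cardSuc natLeq"

end

theory Submission
  imports Defs
begin

text \<open>
  The argument applies the dichotomy to the ideal of all closed discrete subsets of the space.
  In a \<open>T\<^sub>1\<close> space these are exactly the subsets without accumulation points, which is the form
  used throughout; equivalently, they are the sets that every point sees only finitely often
  in some neighbourhood.

  This ideal is a P-ideal: given countably many closed discrete sets, each of them countable by
  \<open>\<omega>\<^sub>1\<close>-compactness, a point with a compact neighbourhood \<open>K\<close> yields the function that bounds,
  for each \<open>n\<close>, the indices of the finitely many members of the \<open>n\<close>-th set in \<open>K\<close>. There are at
  most \<open>\<aleph>\<^sub>1 < \<bb>\<close> such functions, so one function \<open>g\<close> dominates them all, and cutting off
  the first \<open>g n\<close> indices of the \<open>n\<close>-th set leaves a union that is still closed discrete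
  (\<open>P_ideal_discrete_closed\<close>).

  The first alternative of the dichotomy would give an uncountable set whose countable subsets are
  closed discrete; by local compactness the set itself would be closed discrete, contradicting
  \<open>\<omega>\<^sub>1\<close>-compactness. The second alternative covers the space by countably many sets \<open>B\<close> none of
  which contains an infinite closed discrete set. Normality transfers this property from \<open>B\<close> to
  its closure (\<open>infinite_discrete_in_closure\<close>), and the closure is then countably compact.
\<close>

section \<open>Accumulation points and countable compactness\<close>

lemma derived_set_empty_iff_locally_finite:
  assumes t1: "t1_space X"
  shows "X derived_set_of S = {} \<longleftrightarrow>
    (\<forall>x\<in>topspace X. \<exists>U. openin X U \<and> x \<in> U \<and> finite (S \<inter> U))"
proof -
  have "X derived_set_of S =
      {x \<in> topspace X. \<forall>U. x \<in> U \<and> openin X U \<longrightarrow> infinite (S \<inter> U)}"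
    using t1 unfolding t1_space_derived_set_of_infinite_openin by blast
  then show ?thesis by blast
qed

text \<open>
  If no finite part of a cover \<open>u\<^sub>0, u\<^sub>1, \<dots>\<close> suffices, points \<open>x\<^sub>n\<close> outside
  \<open>u\<^sub>0 \<union> \<dots> \<union> u\<^bsub>n-1\<^esub>\<close> form a sequence that visits each member of the cover only finitely
  often; hence its range is infinite and has no accumulation point.
\<close>

lemma countably_compact_space_if_accumulation_points:
  assumes t1: "t1_space X"
    and acc: "\<And>D. D \<subseteq> topspace X \<Longrightarrow> infinite D \<Longrightarrow> X derived_set_of D \<noteq> {}"
  shows "countably_compact_space X"
  unfolding countably_compact_space_def
proof (intro allI impI, elim conjE)
  fix \<U> assume cU: "countable \<U>" and opn: "\<forall>U\<in>\<U>. openin X U" and cov: "topspace X \<subseteq> \<Union>\<U>"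
  show "\<exists>\<F>. finite \<F> \<and> \<F> \<subseteq> \<U> \<and> topspace X \<subseteq> \<Union>\<F>"
  proof (rule ccontr)
    assume no: "\<not> ?thesis"
    then have ne: "\<U> \<noteq> {}" using cov by blast
    define u where "u = from_nat_into \<U>"
    have uU: "range u = \<U>"
      unfolding u_def by (simp add: cU ne range_from_nat_into)
    have "\<exists>x. x \<in> topspace X \<and> (\<forall>i<n. x \<notin> u i)" for n :: nat
    proof -
      have "finite (u ` {..<n}) \<and> u ` {..<n} \<subseteq> \<U>" using uU by auto
      then have "\<not> topspace X \<subseteq> \<Union>(u ` {..<n})" using no by blast
      then show ?thesis by auto
    qed
    then obtain x :: "nat \<Rightarrow> 'a" where xX: "\<And>n. x n \<in> topspace X"
      and xu: "\<And>n i. i < n \<Longrightarrow> x n \<notin> u i"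
      by metis
    have fin: "finite {n. x n \<in> u i}" for i
    proof (rule finite_subset)
      show "{n. x n \<in> u i} \<subseteq> {..i}" using xu not_less by auto
    qed simp
    have inf: "infinite (range x)"
    proof
      assume "finite (range x)"
      then obtain y where y: "y \<in> range x" "infinite (x -` {y})"
        using inf_img_fin_dom[of x UNIV] by auto
      then obtain i where "y \<in> u i" using xX cov uU by blast
      then have "x -` {y} \<subseteq> {n. x n \<in> u i}" by auto
      then show False using fin y(2) finite_subset by blast
    qed
    have "range x \<subseteq> topspace X" using xX by auto
    from acc[OF this inf] obtain y where y: "y \<in> topspace X"
      and yinf: "\<And>U. openin X U \<Longrightarrow> y \<in> U \<Longrightarrow> infinite (range x \<inter> U)"
      unfolding derived_set_empty_iff_locally_finite[OF t1] by blast
    obtain i where i: "y \<in> u i" using y cov uU by blast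
    have "openin X (u i)" using opn uU by blast
    then have "infinite (range x \<inter> u i)"
      using yinf i by blast
    moreover have "range x \<inter> u i \<subseteq> x ` {n. x n \<in> u i}" by auto
    ultimately show False using fin[of i] finite_surj by blast
  qed
qed

text \<open>
  An infinite closed discrete sequence in a normal space carries a continuous function that takes
  the value \<open>n\<close> at its \<open>n\<close>-th point. Moving each point slightly into \<open>B\<close> keeps the values apart,
  and points with values that stay apart cannot accumulate.
\<close>

lemma infinite_discrete_in_closure:
  assumes norm: "normal_space X" and t1: "t1_space X"
    and D: "D \<subseteq> X closure_of B" "infinite D" "X derived_set_of D = {}"
  obtains E where "E \<subseteq> B" "infinite E" "X derived_set_of E = {}"
proof -
  obtain e :: "nat \<Rightarrow> 'a" where e: "inj e" "range e \<subseteq> D"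
    using infinite_countable_subset[OF D(2)] by blast
  have eX: "range e \<subseteq> topspace X"
    using e(2) D(1) closure_of_subset_topspace by fastforce
  have de: "X derived_set_of (range e) = {}"
    using derived_set_of_mono[OF e(2)] D(3) by blast
  have clo: "closedin X (range e)"
    using de eX by (simp add: closedin_contains_derived_set)
  have "subtopology X (range e) = discrete_topology (range e)"
    using de eX by (simp add: subtopology_eq_discrete_topology_eq)
  then have contf: "continuous_map (subtopology X (range e)) euclideanreal (\<lambda>y. real (inv e y))"
    by simp
  obtain g :: "'a \<Rightarrow> real" where g: "continuous_map X euclideanreal g"
    and g_inv: "\<And>y. y \<in> range e \<Longrightarrow> g y = real (inv e y)"
  proof (rule Tietze_extension_realinterval[OF norm clo is_interval_univ UNIV_not_empty contf subset_UNIV])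
    fix g :: "'a \<Rightarrow> real"
    assume "continuous_map X euclideanreal g" "\<And>y. y \<in> range e \<Longrightarrow> g y = real (inv e y)"
    then show thesis by (rule that)
  qed
  have ge: "g (e n) = real n" for n
    using g_inv[of "e n"] e(1) by simp
  have opn: "openin X {y \<in> topspace X. g y \<in> ball c (1/4)}" for c
    using g by (rule openin_continuous_map_preimage) simp
  have "\<exists>b. b \<in> B \<and> b \<in> topspace X \<and> \<bar>g b - real n\<bar> < 1/4" for n
  proof -
    have "e n \<in> D" using e(2) by auto
    then have "e n \<in> X closure_of B" using D(1) by auto
    then have closure: "\<forall>T. e n \<in> T \<and> openin X T \<longrightarrow> (\<exists>y. y \<in> B \<and> y \<in> T)"
      unfolding in_closure_of by (rule conjunct2)
    have "e n \<in> {y \<in> topspace X. g y \<in> ball (real n) (1/4)}"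
      using eX ge[of n] by auto
    from closure[rule_format, OF conjI, OF this opn]
    obtain y where "y \<in> B" "y \<in> {y \<in> topspace X. g y \<in> ball (real n) (1/4)}"
      by (elim exE conjE)
    then show ?thesis
      by (intro exI[of _ y]) (simp add: dist_real_def abs_minus_commute)
  qed
  then obtain b where b: "\<And>n. b n \<in> B" "\<And>n. b n \<in> topspace X"
    and gb: "\<And>n. \<bar>g (b n) - real n\<bar> < 1/4"
    by metis
  \<comment> \<open>Four errors of less than \<open>1/4\<close> add up to less than the distance between distinct integers.\<close>
  have close: "m = n" if "\<bar>g (b m) - c\<bar> < 1/4" "\<bar>g (b n) - c\<bar> < 1/4" for m n c
  proof -
    have "\<bar>real m - real n\<bar> < 1" using that gb[of m] gb[of n] by linarith
    then show ?thesis by linarith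
  qed
  have "inj b"
  proof (rule injI)
    fix m n assume "b m = b n"
    then show "m = n" using gb[of n] by (intro close[of m "real n" n]) simp_all
  qed
  then have "infinite (range b)"
    by (rule range_inj_infinite)
  moreover have "X derived_set_of (range b) = {}"
    unfolding derived_set_empty_iff_locally_finite[OF t1]
  proof
    fix x assume x: "x \<in> topspace X"
    let ?U = "{y \<in> topspace X. g y \<in> ball (g x) (1/4)}"
    have single: "m = n" if "b m \<in> ?U" "b n \<in> ?U" for m n
      using that by (intro close[of m "g x" n]) (simp_all add: dist_real_def abs_minus_commute)
    have "finite {n. b n \<in> ?U}"
    proof (cases "{n. b n \<in> ?U} = {}")
      case True
      then show ?thesis by (simp only: finite.emptyI)
    next
      case False
      then obtain m where "b m \<in> ?U" by blast
      then have "{n. b n \<in> ?U} \<subseteq> {m}" using single by blast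
      then show ?thesis by (rule finite_subset) simp
    qed
    then have "finite (b ` {n. b n \<in> ?U})" by (rule finite_imageI)
    moreover have "range b \<inter> ?U = b ` {n. b n \<in> ?U}" by blast
    ultimately have "finite (range b \<inter> ?U)" by argo
    moreover have "x \<in> ?U" using x by simp
    ultimately show "\<exists>U. openin X U \<and> x \<in> U \<and> finite (range b \<inter> U)"
      using opn[of "g x"] by (intro exI[of _ ?U] conjI)
  qed
  moreover have "range b \<subseteq> B"
    using b(1) by auto
  ultimately show thesis
    by (intro that[of "range b"])
qed

lemma countably_compact_closure:
  assumes norm: "normal_space X" and t1: "t1_space X"
    and fin: "\<And>E. E \<subseteq> B \<Longrightarrow> X derived_set_of E = {} \<Longrightarrow> finite E"
  shows "countably_compact_space (subtopology X (X closure_of B))"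
proof (rule countably_compact_space_if_accumulation_points)
  show "t1_space (subtopology X (X closure_of B))"
    using t1 by (rule t1_space_subtopology)
next
  let ?C = "X closure_of B"
  fix D assume D: "D \<subseteq> topspace (subtopology X ?C)" "infinite D"
  then have DC: "D \<subseteq> ?C" by auto
  have "X derived_set_of D \<noteq> {}"
    using infinite_discrete_in_closure[OF norm t1 DC D(2)] fin by metis
  moreover have "X derived_set_of D \<subseteq> ?C"
    using derived_set_of_mono[OF DC] closedin_closure_of[of X B]
    unfolding closedin_contains_derived_set by blast
  ultimately show "subtopology X ?C derived_set_of D \<noteq> {}"
    using DC by (simp add: derived_set_of_subtopology Int_absorb1 Int_absorb2 inf_absorb2)
qed

section \<open>Closed discrete sets in locally compact spaces\<close>

text \<open>
  This rules out the first alternative of the dichotomy. Local compactness is the reason: an infinite trace on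
  a compact neighbourhood would have a countably infinite subset, accumulating in that
  neighbourhood.
\<close>

lemma derived_set_empty_if_countable_subsets:
  assumes t1: "t1_space X" and lc: "locally_compact_space X"
    and cnt: "\<And>C. C \<subseteq> A \<Longrightarrow> countable C \<Longrightarrow> X derived_set_of C = {}"
  shows "X derived_set_of A = {}"
  unfolding derived_set_empty_iff_locally_finite[OF t1]
proof
  fix x assume "x \<in> topspace X"
  then obtain U K where U: "openin X U" "compactin X K" "x \<in> U" "U \<subseteq> K"
    using lc unfolding locally_compact_space_def by blast
  have "finite (A \<inter> U)"
  proof (rule ccontr)
    assume "infinite (A \<inter> U)"
    then obtain C where C: "C \<subseteq> A \<inter> U" "infinite C" "countable C"
      using infinite_countable_subset' by metis
    then have "K \<inter> X derived_set_of C \<noteq> {}"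
      using U by (intro compactin_imp_Bolzano_Weierstrass) auto
    then show False using cnt C by auto
  qed
  then show "\<exists>U. openin X U \<and> x \<in> U \<and> finite (A \<inter> U)"
    using U(1,3) by blast
qed

lemma countable_if_derived_set_empty:
  assumes "omega1_compact_space X" "D \<subseteq> topspace X" "X derived_set_of D = {}"
  shows "countable D"
  using assms unfolding omega1_compact_space_def
  by (simp add: closedin_contains_derived_set subtopology_eq_discrete_topology_eq)

section \<open>The ideal of closed discrete sets\<close>

lemma dominated_if_below_bounding_number:
  fixes F :: "'b \<Rightarrow> nat \<Rightarrow> nat"
  assumes "|A| <o bounding_number"
  obtains g where "\<And>x. x \<in> A \<Longrightarrow> F x \<le>\<^sup>* g"
proof -
  have "|F ` A| \<le>o |A|" by (rule card_of_image)
  then have "|F ` A| <o bounding_number"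
    using assms ordLeq_ordLess_trans by blast
  then have "\<not> unbounded_family (F ` A)"
    using bounding_number_least not_ordLess_ordLeq by blast
  then show thesis
    using that unfolding unbounded_family_def by auto
qed

lemma set_ideal_discrete_closed:
  assumes "t1_space X"
  shows "set_ideal_on (topspace X) {D. D \<subseteq> topspace X \<and> X derived_set_of D = {}}"
proof -
  have "X derived_set_of {x} = {}" for x
    using assms by (simp add: t1_space_derived_set_of_finite)
  moreover have "X derived_set_of J = {}" if "J \<subseteq> I" "X derived_set_of I = {}" for I J
    using derived_set_of_mono[OF that(1)] that(2) by blast
  ultimately show ?thesis
    unfolding set_ideal_on_def by (auto simp: derived_set_of_Union)
qed

lemma P_ideal_discrete_closed:
  assumes t1: "t1_space X" and lc: "locally_compact_space X" and om: "omega1_compact_space X"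
    and card: "|topspace X| <o bounding_number"
  shows "P_ideal_on (topspace X) {D. D \<subseteq> topspace X \<and> X derived_set_of D = {}}"
    (is "P_ideal_on _ ?\<I>")
  unfolding P_ideal_on_def
proof (intro conjI allI impI, goal_cases)
  case 1
  show ?case using t1 by (rule set_ideal_discrete_closed)
next
  case (2 \<Q>)
  then have cQ: "countable \<Q>" and QI: "\<Q> \<subseteq> ?\<I>" by auto
  show ?case
  proof (cases "\<Q> = {}")
    case True
    then show ?thesis by (intro bexI[of _ "{}"]) auto
  next
    case False
    define Q where "Q = from_nat_into \<Q>"
    have rQ: "range Q = \<Q>"
      unfolding Q_def by (simp add: cQ False range_from_nat_into)
    have QX: "Q n \<subseteq> topspace X" and dQ: "X derived_set_of Q n = {}" for n
      using QI rQ by auto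
    define idx where "idx n = to_nat_on (Q n)" for n
    have idx: "inj_on (idx n) (Q n)" for n
      unfolding idx_def
      using countable_if_derived_set_empty[OF om QX dQ] by (rule inj_on_to_nat_on)
    obtain U K where UK: "\<And>x. x \<in> topspace X \<Longrightarrow>
        openin X (U x) \<and> compactin X (K x) \<and> x \<in> U x \<and> U x \<subseteq> K x"
      using lc unfolding locally_compact_space_def by metis
    have fin: "finite (Q n \<inter> U x)" if "x \<in> topspace X" for n x
    proof (rule ccontr)
      assume "infinite (Q n \<inter> U x)"
      then have "K x \<inter> X derived_set_of (Q n \<inter> U x) \<noteq> {}"
        using UK[OF that] by (intro compactin_imp_Bolzano_Weierstrass) auto
      then show False
        using derived_set_of_mono[of "Q n \<inter> U x" "Q n" X] dQ by blast
    qed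
    have "\<exists>m. \<forall>q\<in>Q n \<inter> U x. idx n q < m" if "x \<in> topspace X" for n x
      using finite_nat_set_iff_bounded[of "idx n ` (Q n \<inter> U x)"] fin[OF that] by auto
    then obtain f where f: "\<And>x n q. x \<in> topspace X \<Longrightarrow> q \<in> Q n \<inter> U x \<Longrightarrow> idx n q < f x n"
      by metis
    obtain g where g: "\<And>x. x \<in> topspace X \<Longrightarrow> f x \<le>\<^sup>* g"
      using dominated_if_below_bounding_number[OF card] by metis
    \<comment> \<open>Only the indices below \<open>g n\<close>, finitely many for each \<open>n\<close>, are given up; by the choice
      of \<open>g\<close>, all but finitely many of the remaining pieces miss the neighbourhood of a given point.\<close>
    define I where "I = (\<Union>n. {q \<in> Q n. g n \<le> idx n q})"
    have "X derived_set_of I = {}"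
      unfolding derived_set_empty_iff_locally_finite[OF t1]
    proof
      fix x assume x: "x \<in> topspace X"
      obtain N where N: "\<And>n. N \<le> n \<Longrightarrow> f x n \<le> g n"
        using g[OF x] unfolding eventually_dominated_def eventually_sequentially by blast
      have "I \<inter> U x \<subseteq> (\<Union>n<N. Q n \<inter> U x)"
      proof
        fix q assume "q \<in> I \<inter> U x"
        then obtain n where n: "q \<in> Q n" "g n \<le> idx n q" "q \<in> U x"
          unfolding I_def by blast
        then have "g n < f x n" using f[OF x, of q n] by simp
        then have "n < N" using N[of n] by (meson leD not_less)
        then show "q \<in> (\<Union>n<N. Q n \<inter> U x)" using n by blast
      qed
      then have "finite (I \<inter> U x)"
        using fin[OF x] by (meson finite_UN_I finite_lessThan finite_subset)
      then show "\<exists>U. openin X U \<and> x \<in> U \<and> finite (I \<inter> U)"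
        using UK[OF x] by blast
    qed
    moreover have "I \<subseteq> topspace X"
      using QX unfolding I_def by blast
    moreover have "finite (Q n - I)" for n
    proof (rule inj_on_finite)
      show "inj_on (idx n) (Q n - I)"
        using idx by (rule inj_on_subset) auto
      show "idx n ` (Q n - I) \<subseteq> {..<g n}"
        unfolding I_def by (auto simp: not_le)
    qed simp
    ultimately show ?thesis
      using rQ by (intro bexI[of _ I]) auto
  qed
qed

section \<open>Applying the dichotomy\<close>

theorem theorem2p5:
  fixes X :: "'a topology"
  assumes "P_Ideal_Dichotomy TYPE('a)"
    and "aleph_one <o bounding_number"
    and "Hausdorff_space X"
    and "locally_compact_space X"
    and "omega1_compact_space X"
    and "normal_space X"
    and "|topspace X| =o aleph_one"
  shows "sigma_countably_compact_space X"
proof -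
  have t1: "t1_space X"
    using assms(3) by (rule Hausdorff_imp_t1_space)
  let ?\<I> = "{D. D \<subseteq> topspace X \<and> X derived_set_of D = {}}"
  have "|topspace X| <o bounding_number"
    using assms(7,2) by (rule ordIso_ordLess_trans)
  then have P: "P_ideal_on (topspace X) ?\<I>"
    by (rule P_ideal_discrete_closed[OF t1 assms(4,5)])
  have no_A: "countable A"
    if A: "A \<subseteq> topspace X" and C: "\<And>C. C \<subseteq> A \<Longrightarrow> countable C \<Longrightarrow> C \<in> ?\<I>" for A
  proof (rule countable_if_derived_set_empty[OF assms(5) A])
    show "X derived_set_of A = {}"
    proof (rule derived_set_empty_if_countable_subsets[OF t1 assms(4)])
      show "X derived_set_of C = {}" if "C \<subseteq> A" "countable C" for C
        using C[OF that] by simp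
    qed
  qed
  have dichotomy: "(\<exists>A. A \<subseteq> topspace X \<and> uncountable A \<and> (\<forall>C. C \<subseteq> A \<and> countable C \<longrightarrow> C \<in> ?\<I>)) \<or>
      (\<exists>B :: nat \<Rightarrow> 'a set. topspace X = (\<Union>n. B n) \<and> (\<forall>n. \<forall>I\<in>?\<I>. finite (B n \<inter> I)))"
    using assms(1)[unfolded P_Ideal_Dichotomy_def, THEN spec, THEN spec, THEN mp, OF P] .
  have "\<exists>B :: nat \<Rightarrow> 'a set. topspace X = (\<Union>n. B n) \<and> (\<forall>n. \<forall>I\<in>?\<I>. finite (B n \<inter> I))"
    using dichotomy
  proof (elim disjE exE conjE)
    fix A assume "A \<subseteq> topspace X" "uncountable A" "\<forall>C. C \<subseteq> A \<and> countable C \<longrightarrow> C \<in> ?\<I>"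
    then show ?thesis using no_A[of A] by simp
  qed auto
  then obtain B :: "nat \<Rightarrow> 'a set" where B: "topspace X = (\<Union>n. B n)"
    and fin: "\<And>n I. I \<in> ?\<I> \<Longrightarrow> finite (B n \<inter> I)"
    by auto
  have "countably_compact_space (subtopology X (X closure_of B n))" for n
  proof (rule countably_compact_closure[OF assms(6) t1])
    fix E assume "E \<subseteq> B n" "X derived_set_of E = {}"
    then show "finite E"
      using fin[of E n] B by (auto simp: Int_absorb1)
  qed
  moreover have "(\<Union>n. X closure_of B n) = topspace X"
  proof
    show "(\<Union>n. X closure_of B n) \<subseteq> topspace X"
      by (simp add: UN_least closure_of_subset_topspace)
    have "B n \<subseteq> X closure_of B n" for n
      using B by (intro closure_of_subset) auto
    then show "topspace X \<subseteq> (\<Union>n. X closure_of B n)"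
      unfolding B by (rule UN_mono[OF subset_refl])
  qed
  ultimately show ?thesis
    unfolding sigma_countably_compact_space_def
    by (intro exI[of _ "range (\<lambda>n. X closure_of B n)"]) auto
qed

end
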